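(* Let $T_n\subset\mathbb{R}^2$ ($n=1,2,3,\dots$) be the shrinking tubes and $J\subset\mathbb{R}^2$ the Y-junction defined in the context, with intrinsic metrics $d^T_n$ and $d^J$ respectively. Then for all $a,b\in J$ and arbitrary sequences $a_n\in T_n$, $b_n\in T_n$ with $a_n\to a$ and $b_n\to b$ in the Euclidean metric, one has $$d^T_n(a_n,b_n)\to d^J(a,b)\quad\text{as } n\to\infty.$$
   Context: Let $e_1=(1,0)$, $e_2=(-\tfrac12,\tfrac{\sqrt3}{2})$, $e_3=(-\tfrac12,-\tfrac{\sqrt3}{2})$ and $y_1=(0,1)$, $y_2=(-\tfrac{\sqrt3}{2},-\tfrac12)$, $y_3=(\tfrac{\sqrt3}{2},-\tfrac12)$. For $n\ge1$ and $i=1,2,3$ let $$R_i=\{s e_i+t y_i: s\ge\tfrac{\sqrt3}{3n},\ -\tfrac1n\le t\le\tfrac1n\}.$$ Let $u_1=-\tfrac{2\sqrt3}{3n}e_3$, $u_2=-\tfrac{2\sqrt3}{3n}e_1$, $u_3=-\tfrac{2\sqrt3}{3n}e_2$, $u_4=u_1$, and $$S_i=\{s u_i+t u_{i+1}: 0\le s,t\le1,\ s+t\le1\},\qquad i=1,2,3.$$ The shrinking tube is $T_n=\bigcup_{i=1}^3(R_i\cup S_i)$ (three half-infinite strips of width $2/n$ glued along a central triangle), and the Y-junction is $J=[0,\infty)e_1\cup[0,\infty)e_2\cup[0,\infty)e_3$. The intrinsic metrics $d^T_n$ on $T_n$ and $d^J$ on $J$ are the infimum of Euclidean lengths of curves joining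 two points inside the set. *)

theory Defs
  imports "HOL-Analysis.Analysis"
begin

(* Length of a curve parametrised by [0,1]: supremum of the lengths of inscribed polygons
   with vertices g (t 0), ..., g (t n), where t 0 \<le> ... \<le> t n. Infinite if g is not rectifiable. *)
definition curve_length :: "(real \<Rightarrow> 'a::metric_space) \<Rightarrow> ennreal" where
  "curve_length g =
     (SUP (n, t) \<in> {(n::nat, t::nat \<Rightarrow> real). mono t \<and> range t \<subseteq> {0..1}}.
        \<Sum>i<n. ennreal (dist (g (t i)) (g (t (Suc i)))))"

(* Takes values in [0,\<infinity>]; the infimum is \<infinity> if no rectifiable curve in X joins p and q. *)
definition intrinsic_dist :: "'a::metric_space set \<Rightarrow> 'a \<Rightarrow> 'a \<Rightarrow> ennreal" where
  "intrinsic_dist X p q =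
     (INF g \<in> {g. path g \<and> path_image g \<subseteq> X \<and> pathstart g = p \<and> pathfinish g = q}.
        curve_length g)"

(* The index i ranges over 1, 2, 3 (and 4 for tube_u); other values are irrelevant. *)
definition dir_e :: "nat \<Rightarrow> real^2" where
  "dir_e i = (if i = 1 then vector [1, 0]
              else if i = 2 then vector [- 1/2, sqrt 3 / 2]
              else vector [- 1/2, - sqrt 3 / 2])"

definition dir_y :: "nat \<Rightarrow> real^2" where
  "dir_y i = (if i = 1 then vector [0, 1]
              else if i = 2 then vector [- sqrt 3 / 2, - 1/2]
              else vector [sqrt 3 / 2, - 1/2])"

definition tube_R :: "nat \<Rightarrow> nat \<Rightarrow> (real^2) set" where
  "tube_R n i = {s *\<^sub>R dir_e i + t *\<^sub>R dir_y i | s t.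
     s \<ge> sqrt 3 / (3 * real n) \<and> - 1 / real n \<le> t \<and> t \<le> 1 / real n}"

(* u_1, u_2, u_3 are the opposites of e_3, e_1, e_2, scaled; the last branch gives u_4 = u_1. *)
definition tube_u :: "nat \<Rightarrow> nat \<Rightarrow> real^2" where
  "tube_u n i = (- (2 * sqrt 3 / (3 * real n))) *\<^sub>R
     dir_e (if i = 2 then 1 else if i = 3 then 2 else 3)"

definition tube_S :: "nat \<Rightarrow> nat \<Rightarrow> (real^2) set" where
  "tube_S n i = {s *\<^sub>R tube_u n i + t *\<^sub>R tube_u n (i + 1) | s t.
     0 \<le> s \<and> s \<le> 1 \<and> 0 \<le> t \<and> t \<le> 1 \<and> s + t \<le> 1}"

definition shrinking_tube :: "nat \<Rightarrow> (real^2) set" where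
  "shrinking_tube n = (\<Union>i\<in>{1, 2, 3}. tube_R n i \<union> tube_S n i)"

definition Y_junction :: "(real^2) set" where
  "Y_junction = (\<Union>i\<in>{1, 2, 3}. {s *\<^sub>R dir_e i | s. 0 \<le> s})"

end

theory Submission
  imports Defs
begin

text \<open>
  The tube is star-shaped about 0 and each strip is convex, which bounds intrinsic distances from
  above: by \<open>\<bar>p\<bar> + \<bar>q\<bar>\<close> always, and by \<open>\<bar>p - q\<bar>\<close> for two points of the same strip. From below,
  \<open>\<bar>p - q\<bar>\<close> is a bound, and it is improved for points near different legs: by the intermediate
  value theorem for \<open>x \<mapsto> x \<bullet> e\<^sub>i\<close>, any joining curve meets the cross-section \<open>x \<bullet> e\<^sub>i = 2 / n\<close>, whose
  points in the tube have norm at most \<open>3 / n\<close>; so the distance is at least \<open>\<bar>p\<bar> + \<bar>q\<bar> - 6 / n\<close>.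
  The Y-junction is treated in the same way with the level 0.
\<close>

subsection \<open>Length of curves\<close>

text \<open>\<open>h\<close> plays the role of travelled length: its increments dominate all
  distances, so the sum over an inscribed polygon telescopes.\<close>

lemma curve_length_le:
  fixes g :: "real \<Rightarrow> 'a::metric_space"
  assumes "\<And>s t. 0 \<le> s \<Longrightarrow> s \<le> t \<Longrightarrow> t \<le> 1 \<Longrightarrow> dist (g s) (g t) \<le> h t - h s"
  shows "curve_length g \<le> ennreal (h 1 - h 0)"
  unfolding curve_length_def
proof (rule SUP_least, clarify)
  fix n :: nat and t :: "nat \<Rightarrow> real"
  assume t: "mono t" "range t \<subseteq> {0..1}"
  have rng: "0 \<le> t i" "t i \<le> 1" for i
    using t(2) by (auto simp: image_subset_iff)
  \<comment> \<open>Distances are nonnegative, so \<open>h\<close> is monotone; a polygon that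
    starts after 0 or stops before 1 is therefore covered as well.\<close>
  have mon: "h s \<le> h s'" if "0 \<le> s" "s \<le> s'" "s' \<le> 1" for s s'
    using assms[OF that] zero_le_dist[of "g s" "g s'"] by linarith
  have "(\<Sum>i<n. dist (g (t i)) (g (t (Suc i)))) \<le> (\<Sum>i<n. h (t (Suc i)) - h (t i))"
    by (intro sum_mono assms rng monoD[OF t(1)]) simp
  also have "\<dots> = h (t n) - h (t 0)"
    by (rule sum_lessThan_telescope)
  also have "\<dots> \<le> h 1 - h 0"
    using mon[of "t n" 1] mon[of 0 "t 0"] rng by (intro diff_mono) auto
  finally show "(\<Sum>i<n. ennreal (dist (g (t i)) (g (t (Suc i))))) \<le> ennreal (h 1 - h 0)"
    by (simp add: sum_ennreal ennreal_leI)
qed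

text \<open>The inscribed polygon through the start, \<open>z\<close> and the end already has this
  length.\<close>

lemma curve_length_ge:
  fixes g :: "real \<Rightarrow> 'a::metric_space"
  assumes "z \<in> path_image g"
  shows "ennreal (dist (pathstart g) z + dist z (pathfinish g)) \<le> curve_length g"
proof -
  from assms obtain r where r: "0 \<le> r" "r \<le> 1" "z = g r"
    by (auto simp: path_image_def)
  \<comment> \<open>Constant from index 2 on, since \<open>curve_length\<close> asks for a monotone
    sequence on all of \<open>nat\<close>.\<close>
  define t :: "nat \<Rightarrow> real" where "t i = (if i = 0 then 0 else if i = 1 then r else 1)" for i
  have t: "mono t" "range t \<subseteq> {0..1}"
    using r by (auto simp: t_def mono_def)
  have "ennreal (dist (pathstart g) z + dist z (pathfinish g))
        = (\<Sum>i<2. ennreal (dist (g (t i)) (g (t (Suc i)))))"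
    using r by (simp add: t_def numeral_2_eq_2 pathstart_def pathfinish_def ennreal_plus)
  also have "\<dots> \<le> curve_length g"
    unfolding curve_length_def using t by (intro SUP_upper2[where i = "(2, t)"]) auto
  finally show ?thesis .
qed

lemma curve_length_linepath_join:
  fixes p z q :: "'a::real_normed_vector"
  shows "curve_length (linepath p z +++ linepath z q) \<le> ennreal (dist p z + dist z q)"
proof -
  let ?g = "linepath p z +++ linepath z q"
  \<comment> \<open>The length covered up to time \<open>t\<close>: each segment is traversed in
    half the time, hence the factor 2.\<close>
  define h where "h t = (if t \<le> 1/2 then 2 * t * dist p z else dist p z + (2 * t - 1) * dist z q)"
    for t :: real
  have line: "dist (linepath x y s) (linepath x y t) = (t - s) * dist x y"
    if "s \<le> t" for x y :: 'a and s t
  proof -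
    have "linepath x y s - linepath x y t = (t - s) *\<^sub>R (x - y)"
      by (simp add: linepath_def algebra_simps)
    then show ?thesis
      using that by (simp add: dist_norm)
  qed
  have "dist (?g s) (?g t) \<le> h t - h s" if st: "0 \<le> s" "s \<le> t" "t \<le> 1" for s t
  proof -
    consider "t \<le> 1/2" | "s \<le> 1/2" "1/2 < t" | "1/2 < s"
      by linarith
    then show ?thesis
    proof cases
      case 1
      then show ?thesis
        using st line[of "2 * s" "2 * t" p z] by (simp add: joinpaths_def h_def algebra_simps)
    next
      case 2
      \<comment> \<open>The two times straddle the midpoint, where the curve is at
        \<open>z\<close>.\<close>
      have "dist (?g s) (?g t) \<le> dist (linepath p z (2 * s)) z + dist z (linepath z q (2 * t - 1))"
        using 2 by (simp add: joinpaths_def dist_triangle)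
      also have "\<dots> = h t - h s"
        using 2 line[of "2 * s" 1 p z] line[of 0 "2 * t - 1" z q]
        by (simp add: linepath_0' linepath_1' h_def algebra_simps)
      finally show ?thesis .
    next
      case 3
      then show ?thesis
        using st line[of "2 * s - 1" "2 * t - 1" z q]
        by (simp add: joinpaths_def h_def algebra_simps)
    qed
  qed
  then have "curve_length ?g \<le> ennreal (h 1 - h 0)"
    by (rule curve_length_le)
  then show ?thesis
    by (simp add: h_def)
qed

subsection \<open>Intrinsic distances\<close>

lemma intrinsic_dist_le_via:
  fixes p z q :: "'a::real_normed_vector"
  assumes "closed_segment p z \<subseteq> X" "closed_segment z q \<subseteq> X"
  shows "intrinsic_dist X p q \<le> ennreal (dist p z + dist z q)"
  unfolding intrinsic_dist_def using assms
  by (intro INF_lower2[where i = "linepath p z +++ linepath z q"] curve_length_linepath_join)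
    (auto simp: path_image_join)

lemma intrinsic_dist_le_segment:
  fixes p q :: "'a::real_normed_vector"
  assumes "closed_segment p q \<subseteq> X"
  shows "intrinsic_dist X p q \<le> ennreal (dist p q)"
  using intrinsic_dist_le_via[of p q X q] assms by auto

text \<open>Reduces a lower bound to finding one costly intermediate point on each joining curve;
  the point may depend on the curve.\<close>

lemma intrinsic_dist_ge_via:
  assumes "\<And>g. path g \<Longrightarrow> path_image g \<subseteq> X \<Longrightarrow> pathstart g = p \<Longrightarrow> pathfinish g = q \<Longrightarrow>
    \<exists>z\<in>path_image g. L \<le> dist p z + dist z q"
  shows "ennreal L \<le> intrinsic_dist X p q"
  unfolding intrinsic_dist_def
proof (rule INF_greatest, clarify)
  fix g assume g: "path g" "path_image g \<subseteq> X" "p = pathstart g" "q = pathfinish g"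
  with assms obtain z where "z \<in> path_image g" "L \<le> dist p z + dist z q"
    by metis
  then show "ennreal L \<le> curve_length g"
    using curve_length_ge g order_trans ennreal_leI by metis
qed

text \<open>The starting point itself serves as the intermediate point.\<close>

lemma intrinsic_dist_ge_dist: "ennreal (dist p q) \<le> intrinsic_dist X p q"
  by (rule intrinsic_dist_ge_via) (metis dist_self add_0 order_refl pathstart_in_path_image)

lemma intrinsic_dist_eq_segment:
  fixes p q :: "'a::real_normed_vector"
  assumes "closed_segment p q \<subseteq> X"
  shows "intrinsic_dist X p q = ennreal (dist p q)"
  using intrinsic_dist_le_segment[OF assms] intrinsic_dist_ge_dist by (rule antisym)

text \<open>The hyperplane separates \<open>q\<close> from \<open>p\<close>, so every joining curve
  crosses it at some \<open>z\<close>. Passing from \<open>z\<close> to the origin costs at most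
  \<open>\<epsilon>\<close> in each of the two triangle inequalities.\<close>

lemma intrinsic_dist_ge_cross_section:
  fixes e p q :: "'a::real_inner"
  assumes "q \<bullet> e \<le> c" "c \<le> p \<bullet> e"
    and small: "\<And>z. z \<in> X \<Longrightarrow> z \<bullet> e = c \<Longrightarrow> norm z \<le> \<epsilon>"
  shows "ennreal (norm p + norm q - 2 * \<epsilon>) \<le> intrinsic_dist X p q"
proof (rule intrinsic_dist_ge_via)
  fix g assume g: "path g" "path_image g \<subseteq> X" "pathstart g = p" "pathfinish g = q"
  have "connected (path_image g)" "p \<in> path_image g" "q \<in> path_image g"
    using g by auto
  then obtain z where z: "z \<in> path_image g" "e \<bullet> z = c"
    using connected_ivt_hyperplane[of "path_image g" q p e c] assms(1,2)
    by (auto simp: inner_commute)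
  then have "norm z \<le> \<epsilon>"
    using small g(2) by (auto simp: inner_commute)
  moreover have "norm p \<le> dist p z + norm z" "norm q \<le> dist z q + norm z"
    using norm_triangle_ineq[of "p - z" z] norm_triangle_ineq[of "q - z" z]
    by (auto simp: dist_norm norm_minus_commute)
  ultimately have "norm p + norm q - 2 * \<epsilon> \<le> dist p z + dist z q"
    by linarith
  then show "\<exists>z\<in>path_image g. norm p + norm q - 2 * \<epsilon> \<le> dist p z + dist z q"
    using z(1) by blast
qed

subsection \<open>Geometry of the tube and of the Y-junction\<close>

text \<open>The legs meet at angles of 120 degrees. The negative cosine is what lets a hyperplane
  orthogonal to one leg separate it from the others.\<close>

lemma inner_dir_e:
  assumes "i \<in> {1, 2, 3}" "j \<in> {1, 2, 3}"
  shows "dir_e i \<bullet> dir_e j = (if i = j then 1 else - 1/2)"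
  using assms by (auto simp: dir_e_def inner_vec_def sum_2)

lemma norm_dir_e [simp]: "i \<in> {1, 2, 3} \<Longrightarrow> norm (dir_e i) = 1"
  by (simp add: norm_eq_1 inner_dir_e)

lemma norm_dir_y [simp]: "norm (dir_y i) = 1"
  by (auto simp: dir_y_def norm_eq_1 inner_vec_def sum_2)

lemma inner_dir_y_dir_e: "i \<in> {1, 2, 3} \<Longrightarrow> dir_y i \<bullet> dir_e i = 0"
  by (auto simp: dir_e_def dir_y_def inner_vec_def sum_2)

lemma tube_R_iff:
  "x \<in> tube_R n i \<longleftrightarrow>
    (\<exists>s t. x = s *\<^sub>R dir_e i + t *\<^sub>R dir_y i \<and> sqrt 3 / (3 * real n) \<le> s \<and> \<bar>t\<bar> \<le> 1 / real n)"
  by (auto simp: tube_R_def abs_le_iff; force)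

lemma convex_tube_R: "convex (tube_R n i)"
proof (rule convexI)
  fix x y :: "real^2" and u v :: real
  assume xy: "x \<in> tube_R n i" "y \<in> tube_R n i" and uv: "0 \<le> u" "0 \<le> v" "u + v = 1"
  obtain s t s' t' where x: "x = s *\<^sub>R dir_e i + t *\<^sub>R dir_y i"
    and y: "y = s' *\<^sub>R dir_e i + t' *\<^sub>R dir_y i"
    and s: "s \<in> {sqrt 3 / (3 * real n)..}" "s' \<in> {sqrt 3 / (3 * real n)..}"
    and t: "t \<in> {- 1 / real n..1 / real n}" "t' \<in> {- 1 / real n..1 / real n}"
    using xy by (auto simp: tube_R_def)
  have "u *\<^sub>R x + v *\<^sub>R y = (u * s + v * s') *\<^sub>R dir_e i + (u * t + v * t') *\<^sub>R dir_y i"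
    by (simp add: x y algebra_simps)
  moreover have "u * s + v * s' \<in> {sqrt 3 / (3 * real n)..}"
    using convexD[OF convex_real_interval(1) s uv] by simp
  moreover have "u * t + v * t' \<in> {- 1 / real n..1 / real n}"
    using convexD[OF convex_real_interval(5) t uv] by simp
  ultimately show "u *\<^sub>R x + v *\<^sub>R y \<in> tube_R n i"
    by (auto simp: tube_R_def)
qed

lemma tube_R_subset: "i \<in> {1, 2, 3} \<Longrightarrow> tube_R n i \<subseteq> shrinking_tube n"
  by (auto simp: shrinking_tube_def)

lemma tube_S_subset: "i \<in> {1, 2, 3} \<Longrightarrow> tube_S n i \<subseteq> shrinking_tube n"
  by (auto simp: shrinking_tube_def)

lemma norm_tube_u: "norm (tube_u n i) = 2 * sqrt 3 / (3 * real n)"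
  by (simp add: tube_u_def)

lemma tube_R_norm_le:
  assumes "i \<in> {1, 2, 3}" "x \<in> tube_R n i"
  shows "norm x \<le> \<bar>x \<bullet> dir_e i\<bar> + 1 / real n"
proof -
  obtain s t where x: "x = s *\<^sub>R dir_e i + t *\<^sub>R dir_y i" and t: "\<bar>t\<bar> \<le> 1 / real n"
    using assms(2) by (auto simp: tube_R_iff)
  have "x \<bullet> dir_e i = s"
    using assms(1) by (simp add: x inner_add_left inner_dir_e inner_dir_y_dir_e)
  moreover have "norm x \<le> \<bar>s\<bar> + \<bar>t\<bar>"
    using norm_triangle_ineq[of "s *\<^sub>R dir_e i" "t *\<^sub>R dir_y i"] assms(1) by (simp add: x)
  ultimately show ?thesis
    using t by linarith
qed

text \<open>The level 2/n clears everything else: in another strip the \<open>dir_e\<close> part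
  contributes -s/2, which is at most 0, and the \<open>dir_y\<close> part at most 1/n, while the
  triangles lie in the ball of radius 2 sqrt 3 / (3n) < 2/n.\<close>

lemma shrinking_tube_in_tube_R:
  assumes n: "n \<ge> 1" and i: "i \<in> {1, 2, 3}" and x: "x \<in> shrinking_tube n"
    and ge: "2 / real n \<le> x \<bullet> dir_e i"
  shows "x \<in> tube_R n i"
proof -
  have n0: "0 < 1 / real n"
    using n by simp
  from x obtain j where j: "j \<in> {1, 2, 3}" and "x \<in> tube_R n j \<or> x \<in> tube_S n j"
    by (auto simp: shrinking_tube_def)
  then consider "x \<in> tube_R n j" | "x \<in> tube_S n j"
    by blast
  then show ?thesis
  proof cases
    case 1
    then obtain s t where x: "x = s *\<^sub>R dir_e j + t *\<^sub>R dir_y j"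
      and s: "sqrt 3 / (3 * real n) \<le> s" and t: "\<bar>t\<bar> \<le> 1 / real n"
      by (auto simp: tube_R_iff)
    have "0 \<le> s"
      using s order_trans[of 0 "sqrt 3 / (3 * real n)" s] by simp
    have "i = j"
    proof (rule ccontr)
      assume "i \<noteq> j"
      have "t * (dir_y j \<bullet> dir_e i) \<le> \<bar>t\<bar> * \<bar>dir_y j \<bullet> dir_e i\<bar>"
        by (metis abs_ge_self abs_mult)
      also have "\<dots> \<le> \<bar>t\<bar> * 1"
        using Cauchy_Schwarz_ineq2[of "dir_y j" "dir_e i"] i by (intro mult_left_mono) auto
      finally have "x \<bullet> dir_e i \<le> 1 / real n"
        using t \<open>0 \<le> s\<close> \<open>i \<noteq> j\<close> i j by (simp add: x inner_add_left inner_dir_e)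
      then show False
        using ge n0 by (simp add: field_simps)
    qed
    with 1 show ?thesis by simp
  next
    case 2
    then obtain s t where x: "x = s *\<^sub>R tube_u n j + t *\<^sub>R tube_u n (j + 1)"
      and st: "0 \<le> s" "0 \<le> t" "s + t \<le> 1"
      by (auto simp: tube_S_def)
    \<comment> \<open>The chain closes with \<open>norm x < norm x\<close>, so this case is
      void.\<close>
    have "norm x \<le> (s + t) * (2 * sqrt 3 / (3 * real n))"
      using norm_triangle_ineq[of "s *\<^sub>R tube_u n j" "t *\<^sub>R tube_u n (j + 1)"] st
      by (simp add: x norm_tube_u add_divide_distrib distrib_right)
    also have "\<dots> \<le> 1 * (2 * sqrt 3 / (3 * real n))"
      using st by (intro mult_right_mono) auto
    also have "\<dots> < 2 / real n"
    proof -
      have "sqrt 3 < 3"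
        by (rule real_less_lsqrt) auto
      then show ?thesis
        using n by (simp add: field_simps)
    qed
    also have "\<dots> \<le> norm x"
      using ge Cauchy_Schwarz_ineq2[of x "dir_e i"] i by simp
    finally show ?thesis by simp
  qed
qed

text \<open>The strip along \<^term>\<open>dir_e i\<close> is glued to the triangle whose index precedes \<^term>\<open>i\<close> cyclically.\<close>

lemma tube_u_corner:
  assumes "i \<in> {1, 2, 3}"
  obtains k where "k \<in> {1, 2, 3}"
    "tube_u n k = (sqrt 3 / (3 * real n)) *\<^sub>R dir_e i - (1 / real n) *\<^sub>R dir_y i"
    "tube_u n (k + 1) = (sqrt 3 / (3 * real n)) *\<^sub>R dir_e i + (1 / real n) *\<^sub>R dir_y i"
proof -
  \<comment> \<open>For \<open>i = 1\<close> the second corner is \<open>tube_u n 4\<close>, which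
    the default branch of \<open>tube_u\<close> identifies with \<open>tube_u n 1\<close>.\<close>
  define k :: nat where "k = (if i = 1 then 3 else i - 1)"
  have "k \<in> {1, 2, 3}"
    "tube_u n k = (sqrt 3 / (3 * real n)) *\<^sub>R dir_e i - (1 / real n) *\<^sub>R dir_y i"
    "tube_u n (k + 1) = (sqrt 3 / (3 * real n)) *\<^sub>R dir_e i + (1 / real n) *\<^sub>R dir_y i"
    using assms
    by (auto simp: k_def tube_u_def dir_e_def dir_y_def vec_eq_iff forall_2 field_simps)
  then show thesis
    by (rule that)
qed

text \<open>Triangles have 0 as a vertex, so they are stable under shrinking. A shrunk strip point
  either stays in its strip or drops below the base at height \<open>h\<close>, and then it lies in
  the adjacent triangle.\<close>

lemma shrinking_tube_scaleR:
  assumes n: "n \<ge> 1" and x: "x \<in> shrinking_tube n" and c: "0 \<le> c" "c \<le> 1"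
  shows "c *\<^sub>R x \<in> shrinking_tube n"
proof -
  from x obtain i where i: "i \<in> {1, 2, 3}" and "x \<in> tube_R n i \<or> x \<in> tube_S n i"
    by (auto simp: shrinking_tube_def)
  then consider "x \<in> tube_R n i" | "x \<in> tube_S n i"
    by blast
  then show ?thesis
  proof cases
    case 1
    define h where "h = sqrt 3 / (3 * real n)"
    have h: "h > 0"
      using n by (simp add: h_def)
    from 1 obtain s t where x: "x = s *\<^sub>R dir_e i + t *\<^sub>R dir_y i"
      and s: "h \<le> s" and t: "\<bar>t\<bar> \<le> 1 / real n"
      by (auto simp: tube_R_iff h_def)
    have ct: "\<bar>c * t\<bar> \<le> c * (1 / real n)"
      using mult_left_mono[OF t c(1)] c(1) by (simp add: abs_mult)
    show ?thesis
    proof (cases "h \<le> c * s")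
      case True
      have "c * (1 / real n) \<le> 1 * (1 / real n)"
        using c by (intro mult_right_mono) auto
      with ct have "\<bar>c * t\<bar> \<le> 1 / real n"
        by linarith
      then have "c *\<^sub>R x \<in> tube_R n i"
        using True by (auto simp: tube_R_iff x scaleR_right_distrib h_def)
      then show ?thesis
        using tube_R_subset i by blast
    next
      case False
      obtain k where k: "k \<in> {1, 2, 3}"
        and uk: "tube_u n k = h *\<^sub>R dir_e i - (1 / real n) *\<^sub>R dir_y i"
        and uk': "tube_u n (k + 1) = h *\<^sub>R dir_e i + (1 / real n) *\<^sub>R dir_y i"
        using tube_u_corner[OF i] unfolding h_def by metis
      \<comment> \<open>Coordinates of \<open>c *\<^sub>R x\<close> in units of the base height
        \<open>h\<close> and the half-width 1/n. The bounds shown next combine to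
        \<open>\<bar>\<tau>\<bar> \<le> c \<le> \<sigma> \<le> 1\<close>.\<close>
      define \<sigma> \<tau> where "\<sigma> = c * s / h" and "\<tau> = real n * (c * t)"
      have "\<bar>\<tau>\<bar> = real n * \<bar>c * t\<bar>"
        by (simp add: \<tau>_def abs_mult)
      also have "\<dots> \<le> real n * (c * (1 / real n))"
        using ct by (intro mult_left_mono) auto
      also have "\<dots> = c"
        using n by simp
      finally have \<tau>: "\<bar>\<tau>\<bar> \<le> c" .
      have \<sigma>: "c \<le> \<sigma>" "\<sigma> \<le> 1"
        using False h s c(1) by (auto simp: \<sigma>_def field_simps mult_left_mono)
      \<comment> \<open>Solves \<open>\<alpha> + \<beta> = \<sigma>\<close> and
        \<open>\<beta> - \<alpha> = \<tau>\<close>, the coordinates relative to the two corners;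
        both are nonnegative because \<open>\<bar>\<tau>\<bar> \<le> \<sigma>\<close>.\<close>
      define \<alpha> \<beta> where "\<alpha> = (\<sigma> - \<tau>) / 2" and "\<beta> = (\<sigma> + \<tau>) / 2"
      have "\<alpha> *\<^sub>R tube_u n k + \<beta> *\<^sub>R tube_u n (k + 1)
          = ((\<alpha> + \<beta>) * h) *\<^sub>R dir_e i + ((\<beta> - \<alpha>) / real n) *\<^sub>R dir_y i"
        unfolding uk uk' by (simp add: algebra_simps diff_divide_distrib)
      also have "\<alpha> + \<beta> = \<sigma>"
        by (simp add: \<alpha>_def \<beta>_def field_simps)
      also have "\<beta> - \<alpha> = \<tau>"
        by (simp add: \<alpha>_def \<beta>_def field_simps)
      also have "(\<sigma> * h) *\<^sub>R dir_e i + (\<tau> / real n) *\<^sub>R dir_y i = c *\<^sub>R x"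
        using h n by (simp add: \<sigma>_def \<tau>_def x algebra_simps)
      finally have "c *\<^sub>R x = \<alpha> *\<^sub>R tube_u n k + \<beta> *\<^sub>R tube_u n (k + 1)"
        by simp
      moreover have "0 \<le> \<alpha>" "0 \<le> \<beta>" "\<alpha> + \<beta> \<le> 1" "\<alpha> \<le> 1" "\<beta> \<le> 1"
        using \<sigma> \<tau> c by (auto simp: \<alpha>_def \<beta>_def abs_le_iff field_simps)
      ultimately have "c *\<^sub>R x \<in> tube_S n k"
        unfolding tube_S_def by blast
      then show ?thesis
        using tube_S_subset k by blast
    qed
  next
    case 2
    then obtain s t where x: "x = s *\<^sub>R tube_u n i + t *\<^sub>R tube_u n (i + 1)"
      and st: "0 \<le> s" "s \<le> 1" "0 \<le> t" "t \<le> 1" "s + t \<le> 1"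
      by (auto simp: tube_S_def)
    have "c *\<^sub>R x = (c * s) *\<^sub>R tube_u n i + (c * t) *\<^sub>R tube_u n (i + 1)"
      by (simp add: x scaleR_right_distrib)
    moreover have "c * s + c * t \<le> 1"
      using mult_mono[of c 1 "s + t" 1] c st by (simp add: distrib_left)
    moreover have "0 \<le> c * s" "c * s \<le> 1" "0 \<le> c * t" "c * t \<le> 1"
      using c st by (auto intro: mult_le_one)
    ultimately have "c *\<^sub>R x \<in> tube_S n i"
      unfolding tube_S_def by blast
    then show ?thesis
      using tube_S_subset i by blast
  qed
qed

lemma closed_segment_0_subset:
  assumes "\<And>c. 0 \<le> c \<Longrightarrow> c \<le> 1 \<Longrightarrow> c *\<^sub>R x \<in> X"
  shows "closed_segment 0 x \<subseteq> X" "closed_segment x 0 \<subseteq> X"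
  using assms by (auto simp: closed_segment_commute[of x 0] closed_segment_def)

lemma intrinsic_dist_shrinking_tube_le:
  assumes "n \<ge> 1" "p \<in> shrinking_tube n" "q \<in> shrinking_tube n"
  shows "intrinsic_dist (shrinking_tube n) p q \<le> ennreal (norm p + norm q)"
  using intrinsic_dist_le_via[of p 0 "shrinking_tube n" q] assms
  by (simp add: closed_segment_0_subset shrinking_tube_scaleR)

lemma Y_junction_scaleR:
  assumes "x \<in> Y_junction" "0 \<le> c"
  shows "c *\<^sub>R x \<in> Y_junction"
proof -
  obtain i s where "i \<in> {1, 2, 3}" "x = s *\<^sub>R dir_e i" "0 \<le> s"
    using assms(1) unfolding Y_junction_def by blast
  then have "c *\<^sub>R x = (c * s) *\<^sub>R dir_e i" "0 \<le> c * s" "i \<in> {1, 2, 3}"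
    using assms(2) by auto
  then show ?thesis
    unfolding Y_junction_def by blast
qed

lemma intrinsic_dist_Y_junction_le:
  assumes "p \<in> Y_junction" "q \<in> Y_junction"
  shows "intrinsic_dist Y_junction p q \<le> ennreal (norm p + norm q)"
  using intrinsic_dist_le_via[of p 0 Y_junction q] assms
  by (simp add: closed_segment_0_subset Y_junction_scaleR)

text \<open>On a leg the inner product is \<open>s\<close> or -s/2, so it vanishes only at the
  origin.\<close>

lemma Y_junction_cross_section_0:
  assumes "z \<in> Y_junction" "i \<in> {1, 2, 3}" "z \<bullet> dir_e i = 0"
  shows "z = 0"
proof -
  obtain j s where "j \<in> {1, 2, 3}" "z = s *\<^sub>R dir_e j"
    using assms(1) unfolding Y_junction_def by blast
  then show ?thesis
    using assms by (auto simp: inner_dir_e split: if_splits)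
qed

lemma convex_leg: "convex {s *\<^sub>R e | s. 0 \<le> (s::real)}"
  for e :: "'a::real_vector"
proof -
  have "{s *\<^sub>R e | s. 0 \<le> s} = (\<lambda>s. s *\<^sub>R e) ` {0..}"
    by auto
  then show ?thesis
    by (simp add: convex_linear_image linear_scale_left)
qed

text \<open>The inner products tend to \<open>r > 0\<close> while the level 2/n tends to 0, so the
  points end up beyond the level.\<close>

lemma eventually_in_tube_R:
  assumes "\<And>n. n \<ge> 1 \<Longrightarrow> A n \<in> shrinking_tube n" "A \<longlonglongrightarrow> r *\<^sub>R dir_e i" "i \<in> {1, 2, 3}" "r > 0"
  shows "eventually (\<lambda>n. 2 / real n < A n \<bullet> dir_e i \<and> A n \<in> tube_R n i) sequentially"
proof -
  have "(\<lambda>n. A n \<bullet> dir_e i - 2 / real n) \<longlonglongrightarrow> (r *\<^sub>R dir_e i) \<bullet> dir_e i - 0"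
    by (intro tendsto_intros assms lim_const_over_n)
  then have "eventually (\<lambda>n. 0 < A n \<bullet> dir_e i - 2 / real n) sequentially"
    using assms(3,4) by (intro order_tendstoD) (auto simp: inner_dir_e)
  with eventually_ge_at_top[of 1] show ?thesis
    by eventually_elim (use assms in \<open>auto intro: shrinking_tube_in_tube_R\<close>)
qed

subsection \<open>Convergence\<close>

theorem theorem5p1:
  fixes a b :: "real^2" and A B :: "nat \<Rightarrow> real^2"
  assumes "a \<in> Y_junction" and "b \<in> Y_junction"
    and "\<And>n. n \<ge> 1 \<Longrightarrow> A n \<in> shrinking_tube n"
    and "\<And>n. n \<ge> 1 \<Longrightarrow> B n \<in> shrinking_tube n"
    and "A \<longlonglongrightarrow> a" and "B \<longlonglongrightarrow> b"
  shows "(\<lambda>n. intrinsic_dist (shrinking_tube n) (A n) (B n)) \<longlonglongrightarrow> intrinsic_dist Y_junction a b"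
proof -
  let ?d = "\<lambda>n. intrinsic_dist (shrinking_tube n) (A n) (B n)"
  have dist_lim: "(\<lambda>n. ennreal (dist (A n) (B n))) \<longlonglongrightarrow> ennreal (dist a b)"
    by (intro tendsto_intros assms)
  have norm_lim: "(\<lambda>n. ennreal (norm (A n) + norm (B n))) \<longlonglongrightarrow> ennreal (norm a + norm b)"
    by (intro tendsto_intros assms)
  have le_norm: "eventually (\<lambda>n. ?d n \<le> ennreal (norm (A n) + norm (B n))) sequentially"
    using eventually_ge_at_top[of 1]
    by eventually_elim (intro intrinsic_dist_shrinking_tube_le assms)
  obtain i r where a: "a = r *\<^sub>R dir_e i" and i: "i \<in> {1, 2, 3}" and "0 \<le> r"
    using assms(1) unfolding Y_junction_def by blast
  obtain j s where b: "b = s *\<^sub>R dir_e j" and j: "j \<in> {1, 2, 3}" and "0 \<le> s"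
    using assms(2) unfolding Y_junction_def by blast
  have A_in: "eventually (\<lambda>n. 2 / real n < A n \<bullet> dir_e i \<and> A n \<in> tube_R n i) sequentially"
    if "r > 0"
    by (rule eventually_in_tube_R[OF _ assms(5)[unfolded a] i that]) (rule assms(3))
  have B_in: "eventually (\<lambda>n. 2 / real n < B n \<bullet> dir_e j \<and> B n \<in> tube_R n j) sequentially"
    if "s > 0"
    by (rule eventually_in_tube_R[OF _ assms(6)[unfolded b] j that]) (rule assms(4))
  consider "a = 0 \<or> b = 0" | "i = j" "r > 0" "s > 0" | "i \<noteq> j" "r > 0" "s > 0"
    using \<open>0 \<le> r\<close> \<open>0 \<le> s\<close> a b by fastforce
  then show ?thesis
  proof cases
    case 1
    \<comment> \<open>With one limit at the centre, the Euclidean lower bound and the radial upper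
      bound agree in the limit.\<close>
    then have eq: "dist a b = norm a + norm b"
      by auto
    have "intrinsic_dist Y_junction a b = ennreal (norm a + norm b)"
      using intrinsic_dist_Y_junction_le[OF assms(1,2)] intrinsic_dist_ge_dist[of a b] eq
      by (intro antisym) auto
    moreover have "?d \<longlonglongrightarrow> ennreal (norm a + norm b)"
      by (rule tendsto_sandwich[OF _ le_norm dist_lim[unfolded eq] norm_lim])
        (simp add: intrinsic_dist_ge_dist)
    ultimately show ?thesis by simp
  next
    case 2
    \<comment> \<open>On a common leg, the intrinsic distance is Euclidean both in the junction and,
      for large n, in the tube, by convexity of the leg and of the strip.\<close>
    have "closed_segment a b \<subseteq> {s *\<^sub>R dir_e i | s. 0 \<le> s}"
      using 2 a b by (intro closed_segment_subset convex_leg) auto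
    also have "\<dots> \<subseteq> Y_junction"
      using i unfolding Y_junction_def by blast
    finally have "intrinsic_dist Y_junction a b = ennreal (dist a b)"
      by (rule intrinsic_dist_eq_segment)
    moreover have "eventually (\<lambda>n. ?d n = ennreal (dist (A n) (B n))) sequentially"
      using A_in[OF \<open>r > 0\<close>] B_in[OF \<open>s > 0\<close>]
    proof eventually_elim
      case (elim n)
      then have "closed_segment (A n) (B n) \<subseteq> tube_R n i"
        using \<open>i = j\<close> by (intro closed_segment_subset convex_tube_R) auto
      then show ?case
        using tube_R_subset[OF i] by (intro intrinsic_dist_eq_segment) blast
    qed
    ultimately show ?thesis
      using dist_lim by (simp add: tendsto_cong)
  next
    case 3
    \<comment> \<open>The cross-section bound at level 0 with \<open>\<epsilon> = 0\<close>: the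
      section of the junction there is the origin alone.\<close>
    have "ennreal (norm a + norm b - 2 * 0) \<le> intrinsic_dist Y_junction a b"
    proof (rule intrinsic_dist_ge_cross_section)
      show "b \<bullet> dir_e i \<le> 0" "0 \<le> a \<bullet> dir_e i"
        using 3 i j by (auto simp: a b inner_dir_e)
      show "norm z \<le> 0" if "z \<in> Y_junction" "z \<bullet> dir_e i = 0" for z
        using Y_junction_cross_section_0 that i by simp
    qed
    then have "intrinsic_dist Y_junction a b = ennreal (norm a + norm b)"
      using intrinsic_dist_Y_junction_le[OF assms(1,2)] by (intro antisym) auto
    moreover have "?d \<longlonglongrightarrow> ennreal (norm a + norm b)"
    proof (rule tendsto_sandwich[OF _ le_norm _ norm_lim])
      have "(\<lambda>n. ennreal (norm (A n) + norm (B n) - 2 * (3 / real n)))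
          \<longlonglongrightarrow> ennreal (norm a + norm b - 2 * 0)"
        by (intro tendsto_intros assms lim_const_over_n)
      then show "(\<lambda>n. ennreal (norm (A n) + norm (B n) - 2 * (3 / real n)))
          \<longlonglongrightarrow> ennreal (norm a + norm b)"
        by simp
      have "(\<lambda>n. B n \<bullet> dir_e i) \<longlonglongrightarrow> b \<bullet> dir_e i"
        by (intro tendsto_intros assms)
      \<comment> \<open>The value is -s/2. Strictness makes the sign pass to \<open>B n\<close> for
        large n, which puts \<open>B n\<close> below the level 2/n.\<close>
      moreover have "b \<bullet> dir_e i < 0"
        using 3 i j by (simp add: b inner_dir_e)
      ultimately have "eventually (\<lambda>n. B n \<bullet> dir_e i < 0) sequentially"
        by (rule order_tendstoD)
      with eventually_ge_at_top[of 1] A_in[OF \<open>r > 0\<close>]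
      show "eventually (\<lambda>n. ennreal (norm (A n) + norm (B n) - 2 * (3 / real n)) \<le> ?d n) sequentially"
      proof eventually_elim
        case (elim n)
        show ?case
        proof (rule intrinsic_dist_ge_cross_section)
          show "B n \<bullet> dir_e i \<le> 2 / real n"
            by (rule order_trans[of _ 0]) (use elim in auto)
          show "2 / real n \<le> A n \<bullet> dir_e i"
            using elim by simp
          \<comment> \<open>Height 2/n along the strip plus half-width 1/n.\<close>
          show "norm z \<le> 3 / real n"
            if "z \<in> shrinking_tube n" "z \<bullet> dir_e i = 2 / real n" for z
            using shrinking_tube_in_tube_R[of n i z] tube_R_norm_le[of i z n] that elim(1) i by simp
        qed
      qed
    qed
    ultimately show ?thesis by simp
  qed
qed

end
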